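(* Let $A\in\mathbf{R}^{n\times n}$ be a stable matrix, let $V=\{b_1,\dots,b_M\}$ be a finite set of possible input matrix columns $b_i\in\mathbf{R}^n$, let $B_0$ be a (possibly empty) existing input matrix with $n$ rows, and for each $S\subseteq V$ let $W_S$ be the infinite-horizon controllability Gramian associated with $S$. Then the set function $f:2^V\to\mathbf{R}$ defined by $$f(S)=\mathrm{rank}(W_S)$$ is submodular and monotone increasing.
   Context: A matrix $A$ is stable if all its eigenvalues have strictly negative real part (so $\dot x=Ax$ is asymptotically stable). For $S\subseteq V$, $B_S=[B_0\ \ b_s]_{s\in S}$ is the matrix formed by the columns of the fixed (possibly empty) matrix $B_0$ together with the columns in $S$. The infinite-horizon controllability Gramian associated with $S$ is $W_S=\int_0^\infty e^{A\tau}B_SB_S^Te^{A^T\tau}\,d\tau\in\mathbf{R}^{n\times n}$, which is the unique positive semidefinite solution of the Lyapunov equation $AW_S+W_SA^T+B_SB_S^T=0$ when $A$ is stable; if $B_S$ has no columns, $W_S=0$. A set function $f:2^V\to\mathbf{R}$ is submodular if for all $X\subseteq Y\subseteq V$ and all $s\in V\setminus Y$, $f(X\cup\{s\})-f(X)\ge f(Y\cup\{s\})-f(Y)$. It is monotone increasing if $X\subseteq Y\subseteq V$ implies $f(X)\le f(Y)$. *)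

theory Defs
  imports "HOL-Analysis.Analysis"
begin

definition eigenvalue :: "complex^'n^'n \<Rightarrow> complex \<Rightarrow> bool" where
  "eigenvalue A c \<longleftrightarrow> (\<exists>v. v \<noteq> 0 \<and> A *v v = c *s v)"

definition stable_matrix :: "real^'n^'n \<Rightarrow> bool" where
  "stable_matrix A \<longleftrightarrow> (\<forall>c. eigenvalue (map_matrix complex_of_real A) c \<longrightarrow> Re c < 0)"

text \<open>
  The type class instances of \<open>vec\<close> interpret \<open>*\<close> and \<open>^\<close> componentwise, so powers with respect
  to the matrix product are written as iterates of \<open>**\<close>.
\<close>

definition matrix_exp :: "real^'n^'n \<Rightarrow> real^'n^'n" where
  "matrix_exp A = (\<Sum>k. (1 / fact k) *\<^sub>R (((**) A ^^ k) (mat 1)))"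

text \<open>
  A matrix with \<open>n\<close> rows and any number of columns, possibly zero, is represented by the list of its
  columns (the library's matrix type excludes matrices without columns).
  For such a \<open>B\<close>, the following is the matrix product of \<open>B\<close> and its transpose.
\<close>

definition mult_transpose :: "(real^'n) list \<Rightarrow> real^'n^'n" where
  "mult_transpose B = (\<chi> i j. \<Sum>k<length B. (B ! k) $ i * (B ! k) $ j)"

text \<open>
  The columns of \<open>B0\<close> followed by the elements of the finite set \<open>S\<close>, each once, in an
  unspecified order.
\<close>

definition input_matrix :: "(real^'n) list \<Rightarrow> (real^'n) set \<Rightarrow> (real^'n) list" where
  "input_matrix B0 S = B0 @ (SOME bs. set bs = S \<and> distinct bs)"

definition controllability_gramian ::
  "real^'n^'n \<Rightarrow> (real^'n) list \<Rightarrow> (real^'n) set \<Rightarrow> real^'n^'n" where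
  "controllability_gramian A B0 S =
     integral {0..} (\<lambda>\<tau>. matrix_exp (\<tau> *\<^sub>R A) ** mult_transpose (input_matrix B0 S) **
                          matrix_exp (\<tau> *\<^sub>R transpose A))"

definition submodular :: "'a set \<Rightarrow> ('a set \<Rightarrow> real) \<Rightarrow> bool" where
  "submodular V f \<longleftrightarrow>
     (\<forall>X Y s. X \<subseteq> Y \<and> Y \<subseteq> V \<and> s \<in> V - Y \<longrightarrow>
        f (X \<union> {s}) - f X \<ge> f (Y \<union> {s}) - f Y)"

end

theory Submission
  imports Defs "HOL-Computational_Algebra.Fundamental_Theorem_Algebra"
begin

text \<open>
  The quadratic form of the Gramian at \<open>x\<close> is the integral of a sum of squares of the continuous
  functions \<open>t \<mapsto> (e\<^sup>t\<^sup>A b) \<bullet> x\<close>, so the kernel of \<open>W\<^sub>S\<close> is \<open>N\<^sub>0 \<inter> (\<Inter>s\<in>S. K\<^sub>s)\<close> for subspaces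
  \<open>K\<^sub>s\<close> depending only on \<open>s\<close>. Since the rank is the codimension of the kernel, the marginal gain of
  \<open>s\<close> is \<open>dim N - dim (N \<inter> K\<^sub>s) = dim (N + K\<^sub>s) - dim K\<^sub>s\<close> with \<open>N\<close> the kernel of \<open>W\<^sub>S\<close>; it shrinks with
  \<open>N\<close>, hence as \<open>S\<close> grows.

  Stability is needed for the integral to converge. A nonzero polynomial \<open>p\<close> of least degree with
  \<open>p(A) v = 0\<close> has only eigenvalues of \<open>A\<close> as roots. Splitting off one root \<open>l\<close> at a time, the
  coordinates of \<open>e\<^sup>t\<^sup>A v\<close> satisfy \<open>y' = l y + g\<close> where \<open>g\<close> is the same coordinate of
  \<open>e\<^sup>t\<^sup>A (A - l) v\<close>, and exponential decay passes from \<open>g\<close> to \<open>y\<close> because \<open>Re l < 0\<close>.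
\<close>

section \<open>Exponential decay and scalar linear differential equations\<close>

definition expdecay :: "(real \<Rightarrow> 'a::real_normed_vector) \<Rightarrow> bool" where
  "expdecay g \<longleftrightarrow> (\<exists>C \<epsilon>. \<epsilon> > 0 \<and> (\<forall>t\<ge>0. norm (g t) \<le> C * exp (- \<epsilon> * t)))"

text \<open>Lowering the rate only weakens the bound on t >= 0, so it may be chosen below any
  \<delta>. The point is to stay strictly below - Re l when solving y' = l y + g, since equal rates
  would produce an extra factor t.\<close>

lemma expdecayE:
  assumes "expdecay g" "\<delta> > 0"
  obtains C \<epsilon> where "C \<ge> 0" "0 < \<epsilon>" "\<epsilon> < \<delta>" "\<And>t. t \<ge> 0 \<Longrightarrow> norm (g t) \<le> C * exp (- \<epsilon> * t)"
proof -
  obtain C e where e: "e > 0" and C: "\<And>t. t \<ge> 0 \<Longrightarrow> norm (g t) \<le> C * exp (- e * t)"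
    using assms(1) unfolding expdecay_def by blast
  have "C \<ge> 0"
    using C[of 0] norm_ge_zero[of "g 0"] by (simp del: norm_ge_zero)
  moreover have "0 < min e (\<delta>/2)" "min e (\<delta>/2) < \<delta>"
    using e assms(2) by auto
  moreover have "norm (g t) \<le> C * exp (- min e (\<delta>/2) * t)" if "t \<ge> 0" for t
  proof -
    have "C * exp (- e * t) \<le> C * exp (- min e (\<delta>/2) * t)"
      using \<open>C \<ge> 0\<close> that by (intro mult_left_mono) (auto intro: mult_right_mono)
    then show ?thesis
      using C[OF that] by linarith
  qed
  ultimately show thesis
    using that by blast
qed

text \<open>Variation of constants: \<open>w\<close> = exp(-l z) y has derivative exp(-l z) g.
  Bounding this derivative and integrating bounds \<open>w\<close> along the real axis, and
  multiplying back by exp(l t) gives decay of \<open>y\<close>. The functions live on the complex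
  plane because they will be power series with complex coefficients.\<close>

lemma expdecay_linear_ode:
  fixes y g :: "complex \<Rightarrow> complex"
  assumes y: "\<And>z. (y has_field_derivative (l * y z + g z)) (at z)"
    and g: "expdecay (\<lambda>t. g (of_real t))" and "Re l < 0"
  shows "expdecay (\<lambda>t. y (of_real t))"
proof -
  obtain C \<epsilon> where C: "C \<ge> 0" "0 < \<epsilon>" "\<epsilon> < - Re l"
      "\<And>t. t \<ge> 0 \<Longrightarrow> norm (g (of_real t)) \<le> C * exp (- \<epsilon> * t)"
    using expdecayE[OF g, of "- Re l"] assms(3) by auto
  \<comment> \<open>The growth rate of the bound on w'. It is positive by the choice of \<epsilon>,
    so C / \<mu> * exp(\<mu> t) is an increasing antiderivative of that bound.\<close>
  define \<mu> where "\<mu> = - Re l - \<epsilon>"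
  have \<mu>: "\<mu> > 0" using C by (simp add: \<mu>_def)
  define w where "w z = exp (- l * z) * y z" for z
  have w: "(w has_field_derivative exp (- l * z) * g z) (at z)" for z
    unfolding w_def
    by (rule derivative_eq_intros y refl | simp)+ (simp add: algebra_simps)
  have wr: "((\<lambda>t. w (of_real t)) has_vector_derivative exp (- l * of_real t) * g (of_real t)) (at t)"
    for t :: real
    using w by (rule has_vector_derivative_real_field)
  have wb: "norm (w (of_real t) - w 0) \<le> C / \<mu> * exp (\<mu> * t) - C / \<mu>" if "t > 0" for t
  proof -
    have "norm (w (of_real t) - w (of_real 0)) \<le> C / \<mu> * exp (\<mu> * t) - C / \<mu> * exp (\<mu> * 0)"
    proof (rule differentiable_bound_general[OF that])
      show "continuous_on {0..t} (\<lambda>t. w (of_real t))"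
        using wr by (meson continuous_at_imp_continuous_on has_vector_derivative_continuous)
      show "continuous_on {0..t} (\<lambda>t. C / \<mu> * exp (\<mu> * t))"
        by (intro continuous_intros)
      show "((\<lambda>t. C / \<mu> * exp (\<mu> * t)) has_vector_derivative C * exp (\<mu> * x)) (at x)" for x
        unfolding has_real_derivative_iff_has_vector_derivative[symmetric]
        using \<mu> by (auto intro!: derivative_eq_intros)
      show "norm (exp (- l * of_real x) * g (of_real x)) \<le> C * exp (\<mu> * x)" if "0 < x" for x
      proof -
        have "norm (exp (- l * of_real x) * g (of_real x)) \<le> exp (- Re l * x) * (C * exp (- \<epsilon> * x))"
          using C(4)[of x] that by (simp add: norm_mult norm_exp_eq_Re mult_left_mono)
        also have "\<dots> = C * exp (\<mu> * x)"
          by (simp add: \<mu>_def exp_add[symmetric] algebra_simps)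
        finally show ?thesis .
      qed
    qed (use wr in auto)
    then show ?thesis by simp
  qed
  have "norm (y (of_real t)) \<le> (norm (w 0) + C / \<mu>) * exp (- \<epsilon> * t)" if "t \<ge> 0" for t
  proof -
    have "norm (w (of_real t)) \<le> norm (w 0) + C / \<mu> * exp (\<mu> * t)"
    \<comment> \<open>The mean value bound \<open>wb\<close> was obtained on a nondegenerate
      interval only.\<close>
    proof (cases "t = 0")
      case False
      then have "norm (w (of_real t)) \<le> norm (w 0) + (C / \<mu> * exp (\<mu> * t) - C / \<mu>)"
        using wb[of t] that norm_triangle_sub[of "w (of_real t)" "w 0"] by linarith
      moreover have "C / \<mu> \<ge> 0" using C \<mu> by simp
      ultimately show ?thesis by linarith
    qed (use C \<mu> in simp)
    then have "exp (Re l * t) * norm (w (of_real t))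
        \<le> exp (Re l * t) * (norm (w 0) + C / \<mu> * exp (\<mu> * t))"
      by (intro mult_left_mono) auto
    also have "exp (Re l * t) * norm (w (of_real t)) = norm (exp (l * of_real t) * w (of_real t))"
      by (simp add: norm_mult norm_exp_eq_Re)
    also have "exp (l * of_real t) * w (of_real t) = y (of_real t)"
      by (simp add: w_def mult.assoc[symmetric] exp_add[symmetric])
    also have "exp (Re l * t) * (norm (w 0) + C / \<mu> * exp (\<mu> * t))
        = norm (w 0) * exp (Re l * t) + C / \<mu> * exp (- \<epsilon> * t)"
      by (simp add: \<mu>_def exp_add[symmetric] algebra_simps)
    also have "\<dots> \<le> norm (w 0) * exp (- \<epsilon> * t) + C / \<mu> * exp (- \<epsilon> * t)"
    proof -
      have "Re l * t \<le> - \<epsilon> * t"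
        using C that by (intro mult_right_mono) auto
      then show ?thesis
        by (intro add_right_mono mult_left_mono) auto
    qed
    finally show ?thesis by (simp add: algebra_simps)
  qed
  then show ?thesis
    unfolding expdecay_def using C(2) by blast
qed

section \<open>Polynomials in a matrix acting on a vector\<close>

definition poly_apply :: "'a::field^'n^'n \<Rightarrow> 'a poly \<Rightarrow> 'a^'n \<Rightarrow> 'a^'n" where
  "poly_apply A p v = (\<Sum>k\<le>degree p. coeff p k *s ((*v) A ^^ k) v)"

text \<open>Sums for different polynomials can be combined once they run over a common
  range.\<close>

lemma poly_apply_altdef:
  assumes "degree p \<le> N"
  shows "poly_apply A p v = (\<Sum>k\<le>N. coeff p k *s ((*v) A ^^ k) v)"
  unfolding poly_apply_def
  by (rule sum.mono_neutral_left) (use assms in \<open>auto simp: coeff_eq_0\<close>)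

lemma poly_apply_add: "poly_apply A (p + q) v = poly_apply A p v + poly_apply A q v"
  using poly_apply_altdef[of p "max (degree p) (degree q)" A v]
    poly_apply_altdef[of q "max (degree p) (degree q)" A v]
    poly_apply_altdef[of "p + q" "max (degree p) (degree q)" A v]
  by (simp add: degree_add_le sum.distrib[symmetric] vec.scale_left_distrib)

lemma poly_apply_smult: "poly_apply A (smult c p) v = c *s poly_apply A p v"
  using poly_apply_altdef[of "smult c p" "degree p" A v]
  by (simp add: degree_smult_le poly_apply_def vec.scale_sum_right)

lemma poly_apply_pCons_0: "poly_apply A (pCons 0 p) v = poly_apply A p (A *v v)"
  using poly_apply_altdef[of "pCons 0 p" "Suc (degree p)" A v]
  by (simp add: degree_pCons_le poly_apply_def sum.atMost_Suc_shift funpow_swap1 del: sum.atMost_Suc)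

lemma funpow_matrix_vector_mult_add:
  fixes A :: "'a::field^'n^'n"
  shows "((*v) A ^^ k) (v + w) = ((*v) A ^^ k) v + ((*v) A ^^ k) w"
  by (induction k) (auto simp: matrix_vector_right_distrib)

lemma funpow_matrix_vector_mult_smult:
  fixes A :: "'a::field^'n^'n"
  shows "((*v) A ^^ k) (c *s v) = c *s ((*v) A ^^ k) v"
  by (induction k) (auto simp: vector_scalar_commute)

lemma poly_apply_vec_add: "poly_apply A p (v + w) = poly_apply A p v + poly_apply A p w"
  by (simp add: poly_apply_def funpow_matrix_vector_mult_add vec.scale_right_distrib sum.distrib)

lemma poly_apply_vec_smult: "poly_apply A p (c *s v) = c *s poly_apply A p v"
  by (simp add: poly_apply_def funpow_matrix_vector_mult_smult vec.scale_sum_right mult.commute)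

lemma poly_apply_mult_vec: "poly_apply A p (A *v v) = A *v poly_apply A p v"
  by (simp add: poly_apply_def matrix_vector_right_distrib vec.linear_sum[OF matrix_vector_mul_linear_gen]
      vector_scalar_commute funpow_swap1)

lemma poly_apply_linear_factor:
  "poly_apply A ([:- l, 1:] * p) v = A *v poly_apply A p v - l *s poly_apply A p v"
proof -
  have "poly_apply A ([:- l, 1:] * p) v = - l *s poly_apply A p v + poly_apply A p (A *v v)"
    by (simp add: poly_apply_add poly_apply_smult poly_apply_pCons_0 del: smult_minus_left)
  then show ?thesis by (simp add: vec.scale_minus_left poly_apply_mult_vec)
qed

text \<open>Since p(A) commutes with A, the linear factor may act before p(A) instead of after it.
  Acting after, it exhibits eigenvectors; acting first, it trades a root of the polynomial for a new
  vector, which drives the induction on the degree.\<close>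

lemma poly_apply_linear_factor':
  "poly_apply A ([:- l, 1:] * p) v = poly_apply A p (A *v v - l *s v)"
  unfolding poly_apply_linear_factor
  using poly_apply_vec_add[of A p "A *v v - l *s v" "l *s v"]
  by (simp add: poly_apply_vec_smult poly_apply_mult_vec)

text \<open>The n + 1 vectors v, A v, ..., A^n v in n-dimensional space are linearly dependent.
  Dependence is a notion for sets, so a repetition among these vectors is treated apart: it gives
  the polynomial x^j - x^k.\<close>

lemma exists_annihilating_poly:
  fixes A :: "'a::field^'n^'n"
  shows "\<exists>p. p \<noteq> 0 \<and> poly_apply A p v = 0"
proof (cases "inj_on (\<lambda>k. ((*v) A ^^ k) v) {..CARD('n)}")
  case False
  then obtain j k where jk: "j \<noteq> k" "((*v) A ^^ j) v = ((*v) A ^^ k) v"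
    by (auto simp: inj_on_def)
  define p where "p = monom (1::'a) j + smult (-1) (monom 1 k)"
  have "coeff p j = 1" using jk by (simp add: p_def)
  then have "p \<noteq> 0" by auto
  have "poly_apply A (monom 1 i) v = ((*v) A ^^ i) v" for i
  proof -
    have "poly_apply A (monom 1 i) v = (\<Sum>k\<le>i. if k = i then ((*v) A ^^ i) v else 0)"
      unfolding poly_apply_def by (rule sum.cong) (auto simp: degree_monom_eq)
    then show ?thesis by simp
  qed
  then have "poly_apply A p v = 0"
    unfolding p_def poly_apply_add poly_apply_smult using jk(2) by (simp add: vec.scale_minus_left)
  with \<open>p \<noteq> 0\<close> show ?thesis by blast
next
  case True
  let ?S = "(\<lambda>k. ((*v) A ^^ k) v) ` {..CARD('n)}"
  have "card ?S = CARD('n) + 1"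
    using True by (simp add: card_image)
  moreover have "vec.dim ?S \<le> CARD('n)"
    by (metis dim_subset_UNIV_cart_gen)
  ultimately have "vec.dependent ?S"
    by (intro vec.dependent_biggerset_general) simp
  then obtain u where u: "\<exists>x\<in>?S. u x \<noteq> 0" "(\<Sum>x\<in>?S. u x *s x) = 0"
    using vec.dependent_finite[of ?S] by auto
  then have s: "(\<Sum>k\<le>CARD('n). u (((*v) A ^^ k) v) *s ((*v) A ^^ k) v) = 0"
    using True by (simp add: sum.reindex)
  define p where "p = (\<Sum>k\<le>CARD('n). monom (u (((*v) A ^^ k) v)) k)"
  have cp: "coeff p k = (if k \<le> CARD('n) then u (((*v) A ^^ k) v) else 0)" for k
    by (simp add: p_def coeff_sum)
  have "degree p \<le> CARD('n)"
    by (rule degree_le) (simp add: cp)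
  then have "poly_apply A p v = 0"
    using s by (simp add: poly_apply_altdef cp)
  moreover obtain k where "k \<le> CARD('n)" "u (((*v) A ^^ k) v) \<noteq> 0"
    using u(1) by auto
  then have "coeff p k \<noteq> 0" by (simp add: cp)
  then have "p \<noteq> 0" by auto
  ultimately show ?thesis by blast
qed

text \<open>Take p of least degree. If p = (x - c) q, minimality gives q(A) v nonzero, while (A - c)
  q(A) v = 0, so q(A) v is an eigenvector for c.\<close>

lemma exists_annihilating_poly_eigenvalue_roots:
  fixes A :: "complex^'n^'n"
  shows "\<exists>p. p \<noteq> 0 \<and> poly_apply A p v = 0 \<and> (\<forall>c. poly p c = 0 \<longrightarrow> eigenvalue A c)"
proof -
  obtain p where p: "p \<noteq> 0 \<and> poly_apply A p v = 0"
    and least: "\<And>q. degree q < degree p \<Longrightarrow> \<not> (q \<noteq> 0 \<and> poly_apply A q v = 0)"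
    using exists_annihilating_poly[of A v]
      exists_least_iff[of "\<lambda>n. \<exists>p. degree p = n \<and> p \<noteq> 0 \<and> poly_apply A p v = 0"] by metis
  have "eigenvalue A c" if root: "poly p c = 0" for c
  proof -
    obtain q where q: "p = [:- c, 1:] * q"
      using root unfolding poly_eq_0_iff_dvd by (elim dvdE)
    with p have "q \<noteq> 0" by auto
    then have "degree q < degree p"
      unfolding q by (subst degree_mult_eq) auto
    with least \<open>q \<noteq> 0\<close> have "poly_apply A q v \<noteq> 0" by blast
    moreover have "A *v poly_apply A q v = c *s poly_apply A q v"
      using p poly_apply_linear_factor[of A c q v] by (simp add: q)
    ultimately show ?thesis
      unfolding eigenvalue_def by blast
  qed
  with p show ?thesis by blast
qed

section \<open>Coordinates of the orbits of the exponential as entire functions\<close>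

definition exp_orbit :: "complex^'n^'n \<Rightarrow> 'n \<Rightarrow> complex^'n \<Rightarrow> complex \<Rightarrow> complex" where
  "exp_orbit A i v z = (\<Sum>k. (((*v) A ^^ k) v $ i / fact k) * z ^ k)"

lemma summable_exp_orbit:
  fixes A :: "complex^'n^'n"
  shows "summable (\<lambda>k. (((*v) A ^^ k) v $ i / fact k) * z ^ k)"
proof -
  \<comment> \<open>An operator bound K for A gives |A^k v| <= K^k |v|, so the exponential series at
    K |z| dominates.\<close>
  obtain K where K: "K > 0" "\<And>x. norm (A *v x) \<le> K * norm x"
    using bounded_linear.pos_bounded[OF matrix_vector_mul_bounded_linear[of A]]
    by (auto simp: mult.commute)
  have b: "norm (((*v) A ^^ k) v) \<le> K ^ k * norm v" for k
  proof (induction k)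
    case (Suc k)
    have "norm (((*v) A ^^ Suc k) v) \<le> K * norm (((*v) A ^^ k) v)"
      using K by simp
    also have "\<dots> \<le> K * (K ^ k * norm v)"
      using Suc K by (intro mult_left_mono) auto
    finally show ?case by (simp add: mult.assoc)
  qed simp
  show ?thesis
  proof (rule summable_comparison_test)
    show "summable (\<lambda>k. norm v * (inverse (fact k) * (K * norm z) ^ k))"
      by (intro summable_mult summable_exp)
    show "\<exists>N. \<forall>k\<ge>N. norm ((((*v) A ^^ k) v $ i / fact k) * z ^ k)
        \<le> norm v * (inverse (fact k) * (K * norm z) ^ k)"
    proof (intro exI allI impI)
      fix k
      have "norm (((*v) A ^^ k) v $ i) \<le> K ^ k * norm v"
        using b[of k] Finite_Cartesian_Product.norm_nth_le order_trans by blast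
      then have "norm (((*v) A ^^ k) v $ i) / fact k * norm z ^ k \<le> (K ^ k * norm v) / fact k * norm z ^ k"
        by (intro mult_right_mono divide_right_mono) auto
      then show "norm ((((*v) A ^^ k) v $ i / fact k) * z ^ k)
        \<le> norm v * (inverse (fact k) * (K * norm z) ^ k)"
        by (simp add: norm_mult norm_divide norm_power field_simps)
    qed
  qed
qed

text \<open>Termwise differentiation cancels one factor of the factorial and shifts the iterates by
  one, which amounts to replacing v by A v.\<close>

lemma exp_orbit_has_field_derivative:
  "(exp_orbit A i v has_field_derivative exp_orbit A i (A *v v) z) (at z)"
proof -
  let ?c = "\<lambda>k. ((*v) A ^^ k) v $ i / fact k"
  have "diffs ?c = (\<lambda>k. ((*v) A ^^ k) (A *v v) $ i / fact k)"
    by (auto simp: diffs_def fun_eq_iff funpow_swap1 field_simps simp del: of_nat_Suc)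
  then show ?thesis
    using termdiffs_strong_converges_everywhere[OF summable_exp_orbit[of A v i], of z]
    unfolding exp_orbit_def by simp
qed

lemma exp_orbit_add: "exp_orbit A i (v + w) z = exp_orbit A i v z + exp_orbit A i w z"
  unfolding exp_orbit_def
  by (subst suminf_add[OF summable_exp_orbit summable_exp_orbit])
     (simp add: funpow_matrix_vector_mult_add algebra_simps add_divide_distrib)

lemma exp_orbit_smult: "exp_orbit A i (c *s v) z = c * exp_orbit A i v z"
  unfolding exp_orbit_def
  by (subst suminf_mult[OF summable_exp_orbit, symmetric])
     (simp add: funpow_matrix_vector_mult_smult mult.assoc)

text \<open>Induction on the degree, with v arbitrary because the hypothesis is applied to (A - c) v
  for a root c. A nonzero constant polynomial annihilates only v = 0.\<close>

lemma expdecay_exp_orbit_of_poly: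
  assumes "p \<noteq> 0" "poly_apply A p v = 0" "\<And>c. poly p c = 0 \<Longrightarrow> Re c < 0"
  shows "expdecay (\<lambda>t. exp_orbit A i v (of_real t))"
  using assms
proof (induction "degree p" arbitrary: p v)
  case 0
  then obtain a where "p = [:a:]" "a \<noteq> 0"
    by (metis degree_eq_zeroE pCons_0_0)
  with 0 have "v = 0" by (simp add: poly_apply_def)
  then have "exp_orbit A i v z = 0" for z
    using exp_orbit_smult[of A i 0 0 z] by simp
  then show ?case
    by (auto simp: expdecay_def intro!: exI[of _ 0] exI[of _ 1])
next
  case (Suc n)
  obtain c where c: "poly p c = 0"
    using fundamental_theorem_of_algebra[of p] Suc.hyps(2) by (metis constant_degree nat.simps(3))
  then obtain q where q: "p = [:- c, 1:] * q"
    unfolding poly_eq_0_iff_dvd by (elim dvdE)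
  with Suc have "q \<noteq> 0" by auto
  then have "n = degree q"
    using Suc.hyps(2) unfolding q by (subst (asm) degree_mult_eq) auto
  define w where "w = A *v v - c *s v"
  have "expdecay (\<lambda>t. exp_orbit A i w (of_real t))"
  proof (rule Suc.hyps(1)[OF \<open>n = degree q\<close> \<open>q \<noteq> 0\<close>])
    show "poly_apply A q w = 0"
      using Suc.prems(2) unfolding q poly_apply_linear_factor' w_def .
    show "Re d < 0" if "poly q d = 0" for d
      using Suc.prems(3)[of d] that by (simp add: q)
  qed
  moreover have "(exp_orbit A i v has_field_derivative c * exp_orbit A i v z + exp_orbit A i w z) (at z)"
    for z
    using exp_orbit_has_field_derivative[of A i v z] exp_orbit_add[of A i w "c *s v" z]
    by (simp add: exp_orbit_smult w_def add.commute)
  ultimately show ?case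
    using expdecay_linear_ode Suc.prems(3)[OF c] by blast
qed

lemma expdecay_exp_orbit:
  assumes "\<And>c. eigenvalue A c \<Longrightarrow> Re c < 0"
  shows "expdecay (\<lambda>t. exp_orbit A i v (of_real t))"
  using exists_annihilating_poly_eigenvalue_roots[of A v] expdecay_exp_orbit_of_poly assms by blast

section \<open>Entries of the matrix exponential\<close>

lemma funpow_matrix_mult_commute: "((**) A ^^ k) (mat 1) ** A = A ** ((**) A ^^ k) (mat 1)"
  for A :: "'a::semiring_1^'n^'n"
  by (induction k) (auto simp: matrix_mul_assoc[symmetric])

lemma transpose_funpow_matrix_mult:
  "((**) (transpose A) ^^ k) (mat 1) = transpose (((**) A ^^ k) (mat 1))"
  for A :: "'a::comm_semiring_1^'n^'n"
  by (induction k) (auto simp: matrix_transpose_mul[symmetric] funpow_matrix_mult_commute transpose_mat)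

lemma funpow_scaleR_matrix_mult:
  "((**) (c *\<^sub>R A) ^^ k) (mat 1) = c ^ k *\<^sub>R ((**) A ^^ k) (mat 1)"
  for A :: "real^'n^'n"
  by (induction k)
     (simp_all add: vec_eq_iff matrix_matrix_mult_def sum_distrib_left mult_ac)

text \<open>Applying A^k to the j-th unit vector gives the j-th column of A^k. This identifies the
  entries of the real exponential with complex orbits, for which decay and continuity are
  available.\<close>

lemma funpow_map_matrix_of_real:
  fixes A :: "real^'n^'n"
  shows "((*v) (map_matrix complex_of_real A) ^^ k) (axis j 1) $ i = of_real (((**) A ^^ k) (mat 1) $ i $ j)"
proof (induction k arbitrary: i)
  case 0
  show ?case by (simp add: mat_def axis_def)
next
  case (Suc k)
  have "(map_matrix complex_of_real A *v x) $ i = (\<Sum>l\<in>UNIV. of_real (A $ i $ l) * x $ l)" for x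
    by (simp add: matrix_vector_mult_def map_matrix_def)
  moreover have "(A ** B) $ i $ j = (\<Sum>l\<in>UNIV. A $ i $ l * B $ l $ j)" for B
    by (simp add: matrix_matrix_mult_def)
  ultimately show ?case
    by (simp add: Suc)
qed

lemma summable_matrix_exp_entry:
  fixes A :: "real^'n^'n"
  shows "summable (\<lambda>k. (1 / fact k) * (((**) (t *\<^sub>R A) ^^ k) (mat 1) $ i $ j))"
proof -
  have "summable (\<lambda>k. complex_of_real ((1 / fact k) * (((**) (t *\<^sub>R A) ^^ k) (mat 1) $ i $ j)))"
    using summable_exp_orbit[of "map_matrix complex_of_real A" "axis j 1" i "of_real t"]
    by (simp add: funpow_map_matrix_of_real funpow_scaleR_matrix_mult mult_ac)
  then show ?thesis
    unfolding summable_of_real_iff .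
qed

lemma matrix_exp_nth:
  fixes A :: "real^'n^'n"
  shows "matrix_exp (t *\<^sub>R A) $ i $ j = (\<Sum>k. (1 / fact k) * (((**) (t *\<^sub>R A) ^^ k) (mat 1) $ i $ j))"
proof -
  let ?f = "\<lambda>k. (1 / fact k) *\<^sub>R ((**) (t *\<^sub>R A) ^^ k) (mat 1)"
  \<comment> \<open>Entrywise convergence yields convergence of the matrix series, so the infinite
    sum in \<open>matrix_exp\<close> is a genuine limit that can be read off entry by entry.\<close>
  have "?f sums (\<chi> i j. \<Sum>k. ?f k $ i $ j)"
    unfolding sums_def
    using summable_matrix_exp_entry[of t A, THEN summable_sums]
    by (intro vec_tendstoI) (simp add: sums_def)
  then show ?thesis
    unfolding matrix_exp_def by (simp add: sums_iff)
qed

lemma of_real_matrix_exp_nth: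
  fixes A :: "real^'n^'n"
  shows "complex_of_real (matrix_exp (t *\<^sub>R A) $ i $ j)
    = exp_orbit (map_matrix complex_of_real A) i (axis j 1) (of_real t)"
  unfolding matrix_exp_nth exp_orbit_def suminf_of_real[OF summable_matrix_exp_entry]
  by (simp add: funpow_map_matrix_of_real funpow_scaleR_matrix_mult mult_ac)

lemma matrix_exp_transpose:
  fixes A :: "real^'n^'n"
  shows "matrix_exp (t *\<^sub>R transpose A) = transpose (matrix_exp (t *\<^sub>R A))"
  unfolding vec_eq_iff
  by (simp add: matrix_exp_nth transpose_def[of "matrix_exp (t *\<^sub>R A)"] funpow_scaleR_matrix_mult transpose_funpow_matrix_mult)
     (simp add: transpose_def)

lemma continuous_on_matrix_exp:
  fixes A :: "real^'n^'n"
  shows "continuous_on S (\<lambda>t. matrix_exp (t *\<^sub>R A))"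
proof -
  have "continuous_on S (\<lambda>t. matrix_exp (t *\<^sub>R A) $ i $ j)" for i j
  proof -
    let ?y = "exp_orbit (map_matrix complex_of_real A) i (axis j 1)"
    have "continuous_on UNIV ?y"
      by (intro continuous_at_imp_continuous_on ballI DERIV_isCont[OF exp_orbit_has_field_derivative])
    then have "continuous_on S (\<lambda>t. Re (?y (of_real t)))"
      by (rule continuous_on_Re[OF continuous_on_compose2[OF _ continuous_on_of_real[OF continuous_on_id]]]) simp
    then show ?thesis
      unfolding of_real_matrix_exp_nth[symmetric] by simp
  qed
  then have "continuous_on S (\<lambda>t. \<chi> i. \<chi> j. matrix_exp (t *\<^sub>R A) $ i $ j)"
    by (intro continuous_on_vec_lambda)
  then show ?thesis by simp
qed

lemma expdecay_matrix_exp_nth: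
  fixes A :: "real^'n^'n"
  assumes "stable_matrix A"
  shows "expdecay (\<lambda>t. matrix_exp (t *\<^sub>R A) $ i $ j)"
proof -
  have "expdecay (\<lambda>t. complex_of_real (matrix_exp (t *\<^sub>R A) $ i $ j))"
    unfolding of_real_matrix_exp_nth
    by (rule expdecay_exp_orbit) (use assms in \<open>auto simp: stable_matrix_def\<close>)
  then show ?thesis
    unfolding expdecay_def by simp
qed

section \<open>Convergence of the Gramian integral\<close>

lemma expdecay_mult:
  fixes g h :: "real \<Rightarrow> 'a::real_normed_algebra"
  assumes "expdecay g" "expdecay h"
  shows "expdecay (\<lambda>t. g t * h t)"
proof -
  obtain C e where C: "C \<ge> 0" "0 < e" "\<And>t. t \<ge> 0 \<Longrightarrow> norm (g t) \<le> C * exp (- e * t)"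
    using expdecayE[OF assms(1) zero_less_one] by metis
  obtain D d where D: "D \<ge> 0" "0 < d" "\<And>t. t \<ge> 0 \<Longrightarrow> norm (h t) \<le> D * exp (- d * t)"
    using expdecayE[OF assms(2) zero_less_one] by metis
  have "norm (g t * h t) \<le> (C * D) * exp (- (e + d) * t)" if "t \<ge> 0" for t
  proof -
    have "norm (g t * h t) \<le> norm (g t) * norm (h t)"
      by (rule norm_mult_ineq)
    also have "\<dots> \<le> (C * exp (- e * t)) * (D * exp (- d * t))"
      using C D that by (intro mult_mono) auto
    also have "\<dots> = (C * D) * exp (- (e + d) * t)"
      by (simp add: exp_add[symmetric] algebra_simps)
    finally show ?thesis .
  qed
  moreover have "e + d > 0" using C D by simp
  ultimately show ?thesis unfolding expdecay_def by blast
qed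

lemma expdecay_integrable:
  fixes g :: "real \<Rightarrow> 'a::euclidean_space"
  assumes "expdecay g" "continuous_on {0..} g"
  shows "g integrable_on {0..}"
proof -
  obtain C e where C: "0 < e" "\<And>t. t \<ge> 0 \<Longrightarrow> norm (g t) \<le> C * exp (- e * t)"
    using assms(1) unfolding expdecay_def by blast
  show ?thesis
  proof (rule measurable_bounded_by_integrable_imp_integrable)
    show "g \<in> borel_measurable (lebesgue_on {0..})"
      by (rule continuous_imp_measurable_on_sets_lebesgue[OF assms(2)]) simp
    show "(\<lambda>t. C * exp (- e * t)) integrable_on {0..}"
      by (intro integrable_on_mult_right integrable_on_exp_minus_to_infinity C(1))
  qed (use C in auto)
qed

text \<open>Each entry of the integrand is a linear combination of products of two entries of the
  exponential, so decay of single entries suffices.\<close>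

lemma matrix_triple_product_nth:
  fixes E M :: "'a::comm_semiring_1^'n^'n"
  shows "(E ** M ** transpose E) $ i $ j = (\<Sum>a\<in>UNIV. \<Sum>b\<in>UNIV. M $ b $ a * (E $ i $ b * E $ j $ a))"
  by (simp add: matrix_matrix_mult_def transpose_def sum_distrib_left sum_distrib_right mult_ac)

lemma integrable_gramian:
  fixes A M :: "real^'n^'n"
  assumes "stable_matrix A"
  shows "(\<lambda>t. matrix_exp (t *\<^sub>R A) ** M ** transpose (matrix_exp (t *\<^sub>R A))) integrable_on {0..}"
proof -
  have c: "continuous_on S (\<lambda>t. matrix_exp (t *\<^sub>R A) $ i $ j)" for S i j
    by (intro continuous_intros continuous_on_matrix_exp)
  have "(\<lambda>t. (matrix_exp (t *\<^sub>R A) ** M ** transpose (matrix_exp (t *\<^sub>R A))) $ i $ j) integrable_on {0..}"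
    for i j
    unfolding matrix_triple_product_nth
    by (intro integrable_sum finite integrable_on_mult_right expdecay_integrable expdecay_mult
        expdecay_matrix_exp_nth assms continuous_on_mult c)
  then show ?thesis
    by (subst integrable_componentwise_iff) (auto simp: Basis_vec_def inner_axis)
qed

section \<open>The kernel of the Gramian\<close>

lemma mult_transpose_vec: "mult_transpose B *v x = (\<Sum>k<length B. (B ! k \<bullet> x) *\<^sub>R B ! k)"
proof -
  have "(mult_transpose B *v x) $ i = (\<Sum>k<length B. (B ! k \<bullet> x) *\<^sub>R B ! k) $ i" for i
  proof -
    have "(mult_transpose B *v x) $ i = (\<Sum>j\<in>UNIV. \<Sum>k<length B. B ! k $ i * B ! k $ j * x $ j)"
      by (simp add: mult_transpose_def matrix_vector_mult_def sum_distrib_right)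
    also have "\<dots> = (\<Sum>k<length B. \<Sum>j\<in>UNIV. B ! k $ i * B ! k $ j * x $ j)"
      by (rule sum.swap)
    also have "\<dots> = (\<Sum>k<length B. (B ! k \<bullet> x) * B ! k $ i)"
      by (simp add: inner_vec_def sum_distrib_left sum_distrib_right mult_ac)
    finally show ?thesis by simp
  qed
  then show ?thesis by (simp add: vec_eq_iff)
qed

text \<open>The orthogonal complement of all trajectories starting in S. Imposing a separate
  condition for each b turns unions of input sets into intersections of subspaces.\<close>

definition gramian_kernel :: "real^'n^'n \<Rightarrow> (real^'n) set \<Rightarrow> (real^'n) set" where
  "gramian_kernel A S = {x. \<forall>b\<in>S. \<forall>t\<ge>0. (matrix_exp (t *\<^sub>R A) *v b) \<bullet> x = 0}"

text \<open>If W x = 0 then x . W x = 0 is the integral of the continuous nonnegative function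
  \<open>?q\<close>, which must vanish. Conversely, if \<open>?q\<close> vanishes on t >= 0, so does
  the integrand applied to x.\<close>

lemma gramian_vec_eq_0_iff:
  fixes A :: "real^'n^'n"
  assumes "stable_matrix A"
  shows "integral {0..} (\<lambda>t. matrix_exp (t *\<^sub>R A) ** mult_transpose B ** matrix_exp (t *\<^sub>R transpose A)) *v x = 0
    \<longleftrightarrow> x \<in> gramian_kernel A (set B)"
proof -
  let ?E = "\<lambda>t. matrix_exp (t *\<^sub>R A)"
  let ?G = "\<lambda>t. ?E t ** mult_transpose B ** transpose (?E t)"
  let ?q = "\<lambda>t. \<Sum>k<length B. ((?E t *v B ! k) \<bullet> x)\<^sup>2"
  note int = integrable_gramian[OF assms, of "mult_transpose B"]
  have Bx: "B ! k \<bullet> (transpose (?E t) *v x) = (?E t *v B ! k) \<bullet> x" for t k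
    by (metis dot_lmul_matrix inner_commute transpose_matrix_vector)
  have Gx: "?G t *v x = ?E t *v (\<Sum>k<length B. ((?E t *v B ! k) \<bullet> x) *\<^sub>R B ! k)" for t
    by (simp add: matrix_vector_mul_assoc[symmetric] mult_transpose_vec Bx del: transpose_matrix_vector)
  have xGx: "x \<bullet> (?G t *v x) = ?q t" for t
  proof -
    have "x \<bullet> (?G t *v x)
        = (transpose (?E t) *v x) \<bullet> (\<Sum>k<length B. ((?E t *v B ! k) \<bullet> x) *\<^sub>R B ! k)"
      unfolding Gx by (simp add: dot_lmul_matrix)
    also have "\<dots> = ?q t"
      by (simp add: inner_sum_right inner_commute[of "transpose (?E t) *v x"] Bx power2_eq_square
          del: transpose_matrix_vector)
    finally show ?thesis .
  qed
  have "bounded_linear (\<lambda>M::real^'n^'n. M *v x)"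
    by (intro linear_conv_bounded_linear[THEN iffD1] linearI)
       (auto simp: matrix_vector_mult_add_rdistrib scaleR_matrix_vector_assoc)
  \<comment> \<open>Multiplication by the fixed x is bounded linear in the matrix, so it passes
    under the integral.\<close>
  note Wx = integral_linear[OF int this, unfolded o_def] integrable_linear[OF int this, unfolded o_def]
  have kernel: "x \<in> gramian_kernel A (set B) \<longleftrightarrow> (\<forall>t\<ge>0. ?q t = 0)"
    by (auto simp: gramian_kernel_def sum_nonneg_eq_0_iff all_set_conv_all_nth)
  have "integral {0..} ?G *v x = 0 \<longleftrightarrow> (\<forall>t\<ge>0. ?q t = 0)"
  proof
    assume "integral {0..} ?G *v x = 0"
    then have "integral {0..} (\<lambda>t. ?G t *v x) = 0" by (simp add: Wx)
    then have q0: "integral {0..} ?q = 0"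
      using integral_linear[OF Wx(2) bounded_linear_inner_right[of x]] by (simp add: o_def xGx)
    have qint: "?q integrable_on {0..}"
      using integrable_linear[OF Wx(2) bounded_linear_inner_right[of x]] by (simp add: o_def xGx)
    have cont: "continuous_on T ?q" for T
      unfolding matrix_vector_mult_def inner_vec_def
      by (intro continuous_intros continuous_on_matrix_exp)
    show "\<forall>t\<ge>0. ?q t = 0"
    proof (intro allI impI)
      fix t :: real assume "t \<ge> 0"
      \<comment> \<open>A compact interval that contains t and has positive length even for t = 0;
        its integral is squeezed between 0 and the full one.\<close>
      have "?q integrable_on {0..t+1}"
        by (intro integrable_continuous_interval cont)
      then have "integral {0..t+1} ?q \<le> integral {0..} ?q"
        by (intro integral_subset_le qint) (auto intro: sum_nonneg)
      moreover have "integral {0..t+1} ?q \<ge> 0"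
        by (intro integral_nonneg integrable_continuous_interval cont sum_nonneg) auto
      ultimately have "integral {0..t+1} ?q = 0" using q0 by simp
      then show "?q t = 0"
        using integral_eq_0_iff[of 0 "t+1" ?q] cont \<open>t \<ge> 0\<close> by (auto simp: sum_nonneg)
    qed
  next
    assume "\<forall>t\<ge>0. ?q t = 0"
    then have "?G t *v x = 0" if "t \<ge> 0" for t
      using that unfolding Gx by (simp add: sum_nonneg_eq_0_iff)
    then have "integral {0..} (\<lambda>t. ?G t *v x) = 0"
      by (intro integral_unique has_integral_is_0) simp
    then show "integral {0..} ?G *v x = 0"
      by (simp add: Wx)
  qed
  then show ?thesis
    by (simp add: matrix_exp_transpose kernel)
qed

section \<open>Rank, codimension and submodularity\<close>

lemma rank_plus_dim_kernel:
  fixes W :: "real^'n^'m"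
  shows "rank W + dim {x. W *v x = 0} = CARD('n)"
proof -
  \<comment> \<open>The kernel is the orthogonal complement of the row space, whose dimension is the
    rank.\<close>
  have "{x. W *v x = 0} = {y \<in> UNIV. \<forall>x\<in>span (rows W). orthogonal x y}"
  proof safe
    fix y x assume "W *v y = 0" "x \<in> span (rows W)"
    then show "orthogonal x y"
      using orthogonal_nullspace_rowspace orthogonal_commute by blast
  next
    fix y assume *: "\<forall>x\<in>span (rows W). orthogonal x y"
    have "(W *v y) $ i = 0" for i
      using * span_base[of "row i W" "rows W"]
      by (auto simp: matrix_vector_mul_component orthogonal_def rows_def row_def)
    then show "W *v y = 0" by (simp add: vec_eq_iff)
  qed simp
  then show ?thesis
    using dim_subspace_orthogonal_to_vectors[of "span (rows W)" UNIV] by (simp add: row_rank_def)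
qed

text \<open>A finite set has a duplicate-free enumeration, so the choice in
  \<open>input_matrix\<close> is well founded; the kernel depends only on the resulting set of
  columns.\<close>

lemma set_input_matrix: "finite S \<Longrightarrow> set (input_matrix B0 S) = set B0 \<union> S"
  unfolding input_matrix_def
  using someI_ex[OF finite_distinct_list, of S] by simp

lemma rank_controllability_gramian:
  fixes A :: "real^'n^'n"
  assumes "stable_matrix A" "finite S"
  shows "rank (controllability_gramian A B0 S) + dim (gramian_kernel A (set B0 \<union> S)) = CARD('n)"
proof -
  have "{x. controllability_gramian A B0 S *v x = 0} = gramian_kernel A (set B0 \<union> S)"
    unfolding controllability_gramian_def using gramian_vec_eq_0_iff[OF assms(1)] assms(2)
    by (auto simp: set_input_matrix)
  then show ?thesis
    using rank_plus_dim_kernel by metis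
qed

lemma subspace_gramian_kernel: "subspace (gramian_kernel A S)"
  by (auto simp: subspace_def gramian_kernel_def inner_right_distrib)

lemma gramian_kernel_Un: "gramian_kernel A (S \<union> T) = gramian_kernel A S \<inter> gramian_kernel A T"
  by (auto simp: gramian_kernel_def)

text \<open>By the dimension formula, dim S - dim (S \<inter> U) = dim (S + U) - dim U, and S + U is
  contained in T + U.\<close>

lemma dim_Int_diff_mono:
  fixes S T U :: "'a::euclidean_space set"
  assumes "subspace S" "subspace T" "subspace U" "S \<subseteq> T"
  shows "dim S + dim (T \<inter> U) \<le> dim T + dim (S \<inter> U)"
proof -
  have "dim {x + y |x y. x \<in> S \<and> y \<in> U} \<le> dim {x + y |x y. x \<in> T \<and> y \<in> U}"
    using assms(4) by (intro dim_subset) auto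
  then show ?thesis
    using dim_sums_Int[OF assms(1,3)] dim_sums_Int[OF assms(2,3)] by linarith
qed

theorem theorem7:
  fixes A :: "real^'n^'n"
    and V :: "(real^'n) set"
    and B0 :: "(real^'n) list"
    and f :: "(real^'n) set \<Rightarrow> real"
  assumes "stable_matrix A"
    and "finite V"
    and "\<And>S. S \<subseteq> V \<Longrightarrow> f S = real (rank (controllability_gramian A B0 S))"
  shows "submodular V f \<and> mono_on (Pow V) f"
proof -
  define N where "N S = gramian_kernel A (set B0 \<union> S)" for S
  have f: "f S = real CARD('n) - real (dim (N S))" if "S \<subseteq> V" for S
    using rank_controllability_gramian[OF assms(1) finite_subset[OF that assms(2)], of B0] assms(3)[OF that]
    unfolding N_def by linarith
  have anti: "N Y \<subseteq> N X" if "X \<subseteq> Y" for X Y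
    using that by (auto simp: N_def gramian_kernel_def)
  have "f (Y \<union> {s}) - f Y \<le> f (X \<union> {s}) - f X" if "X \<subseteq> Y" "Y \<subseteq> V" "s \<in> V" for X Y s
  proof -
    \<comment> \<open>Kernels reverse inclusion: the larger input set Y supplies the smaller
      subspace.\<close>
    have "dim (N Y) + dim (N X \<inter> gramian_kernel A {s}) \<le> dim (N X) + dim (N Y \<inter> gramian_kernel A {s})"
      using anti[OF that(1)] by (intro dim_Int_diff_mono) (auto simp: N_def subspace_gramian_kernel)
    moreover have "N (Z \<union> {s}) = N Z \<inter> gramian_kernel A {s}" for Z
      by (simp only: N_def Un_assoc[symmetric] gramian_kernel_Un)
    ultimately have "dim (N Y) + dim (N (X \<union> {s})) \<le> dim (N X) + dim (N (Y \<union> {s}))"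
      by simp
    moreover have "X \<subseteq> V" "X \<union> {s} \<subseteq> V" "Y \<union> {s} \<subseteq> V" using that by auto
    ultimately show ?thesis
      using f that(2) by simp
  qed
  then have "submodular V f"
    by (auto simp: submodular_def)
  moreover have "mono_on (Pow V) f"
  proof (rule mono_onI)
    fix X Y assume "X \<in> Pow V" "Y \<in> Pow V" "X \<subseteq> Y"
    then show "f X \<le> f Y"
      using f dim_subset[OF anti[of X Y]] by simp
  qed
  ultimately show ?thesis by blast
qed

end
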